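(* Let $X$ be a transitive subshift on a finite alphabet. If $\limsup_{n\to\infty} (c_n(X) - n) = \infty$ and $\limsup_{n\to\infty} (c_n(X) - 1.5n) < \infty$, then $X$ is minimal.
   Context: For a finite alphabet $A$, a subshift is a subset $X \subseteq A^{\mathbb{Z}}$ that is closed in the product topology and invariant under the left shift $\sigma$. A subshift $X$ is transitive if $X = \overline{\mathcal{O}(x)}$ for some $x \in A^{\mathbb{Z}}$, where $\mathcal{O}(x) = \{\sigma^n x : n \in \mathbb{Z}\}$. A subshift is minimal if it contains no proper nonempty subshift. $c_n(X)$ is the number of distinct words of length $n$ occurring as (contiguous) subwords of points of $X$. *)

theory Defs
  imports "HOL-Analysis.Analysis"
begin

definition full_shift :: "'a set \<Rightarrow> (int \<Rightarrow> 'a) topology" where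
  "full_shift A = product_topology (\<lambda>_. discrete_topology A) UNIV"

text \<open>The integer power \<open>\<sigma>\<^sup>n\<close> of the left shift.\<close>

definition shift_pow :: "int \<Rightarrow> (int \<Rightarrow> 'a) \<Rightarrow> (int \<Rightarrow> 'a)" where
  "shift_pow n x = (\<lambda>i. x (i + n))"

abbreviation shift :: "(int \<Rightarrow> 'a) \<Rightarrow> (int \<Rightarrow> 'a)" where
  "shift \<equiv> shift_pow 1"

text \<open>Finiteness of the alphabet \<open>A\<close> is not part of the definition.  Shift invariance is
  \<open>\<sigma>(X) = X\<close>; the empty set counts as a subshift.\<close>

definition subshift :: "'a set \<Rightarrow> (int \<Rightarrow> 'a) set \<Rightarrow> bool" where
  "subshift A X \<longleftrightarrow> closedin (full_shift A) X \<and> shift ` X = X"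

definition orbit :: "(int \<Rightarrow> 'a) \<Rightarrow> (int \<Rightarrow> 'a) set" where
  "orbit x = {shift_pow n x | n. True}"

definition transitive_subshift :: "'a set \<Rightarrow> (int \<Rightarrow> 'a) set \<Rightarrow> bool" where
  "transitive_subshift A X \<longleftrightarrow>
     subshift A X \<and> (\<exists>x \<in> topspace (full_shift A). X = full_shift A closure_of orbit x)"

definition minimal_subshift :: "'a set \<Rightarrow> (int \<Rightarrow> 'a) set \<Rightarrow> bool" where
  "minimal_subshift A X \<longleftrightarrow>
     subshift A X \<and> \<not> (\<exists>Y. subshift A Y \<and> Y \<noteq> {} \<and> Y \<subset> X)"

definition words :: "(int \<Rightarrow> 'a) set \<Rightarrow> nat \<Rightarrow> 'a list set" where
  "words X n = {map (\<lambda>j. x (k + int j)) [0..<n] | x k. x \<in> X}"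

definition complexity :: "(int \<Rightarrow> 'a) set \<Rightarrow> nat \<Rightarrow> nat" where
  "complexity X n = card (words X n)"

lemma topspace_full_shift: "topspace (full_shift A) = {x. \<forall>i. x i \<in> A}"
  by (auto simp: full_shift_def PiE_def Pi_def)

lemma finite_words:
  assumes "finite A" "subshift A X"
  shows "finite (words X n)"
proof (rule finite_subset)
  have "x i \<in> A" if "x \<in> X" for x i
    using closedin_subset[of "full_shift A" X] assms(2) that
    unfolding subshift_def topspace_full_shift by blast
  then show "words X n \<subseteq> {xs. set xs \<subseteq> A \<and> length xs = n}"
    by (auto simp: words_def)
  show "finite {xs. set xs \<subseteq> A \<and> length xs = n}"
    using assms(1) by (rule finite_lists_length_eq)
qed

end

theory Submission
  imports Defs
begin

text \<open>
  Suppose that \<open>X\<close>, the orbit closure of \<open>x\<close>, is not minimal, and pick a point \<open>y\<close> in a proper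
  nonempty subshift of \<open>X\<close>.  Every word of \<open>y\<close> occurs in \<open>x\<close>, but some word \<open>w\<close> of \<open>x\<close> does not
  occur in \<open>y\<close>.  Write \<open>c\<^sub>n\<close> for the number of words of length \<open>n\<close> in \<open>x\<close>, equivalently in \<open>X\<close>.  The
  first growth hypothesis only serves to exclude that \<open>x\<close> is eventually periodic in both
  directions (\<open>eventually_periodic_complexity\<close>); the aim is that \<open>c\<^sub>n - 3n/2\<close> is unbounded above.

  If \<open>y\<close> is aperiodic, it has at least \<open>n + 1\<close> words of length \<open>n\<close> by Morse and Hedlund.  None of
  them contains \<open>w\<close>, whereas \<open>x\<close> has about \<open>n\<close> further words of length \<open>n\<close> that do
  (\<open>complexity_with_marker\<close>), so \<open>c\<^sub>n \<ge> 2n - O(1)\<close>.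

  If \<open>y\<close> has period \<open>p\<close>, code the letters by integers and pass to \<open>d\<^sub>i = x\<^sub>i\<^sub>+\<^sub>p - x\<^sub>i\<close>.  Long
  \<open>p\<close>-periodic words of \<open>x\<close> become long runs of zeros, and \<open>d\<close> has at most
  \<open>c\<^sub>n\<^sub>+\<^sub>p\<close> words of length \<open>n\<close>, so it is enough to bound the complexity of \<open>d\<close> from below.  Boundedness of
  \<open>x\<close> prevents \<open>d\<close> from being eventually periodic in both directions
  (\<open>eventually_periodic_antidifference\<close>); after a reflection it is not eventually periodic to the
  right.  If some word of \<open>d\<close> is missing from a right half-line, the marker argument applies again,
  with the words of that half-line in place of those of \<open>y\<close>.  Otherwise every word recurs
  arbitrarily far to the right.  Take a word of \<open>d\<close> of length greater than \<open>C\<close> that begins and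
  ends with a nonzero letter, and extend it as long as the extension is forced.  The result \<open>V\<close> is
  both left and right special, with say \<open>l\<close> leading and \<open>r\<close> trailing zeros and \<open>|V| > l + r + C\<close>.
  Words \<open>0\<^sup>n\<close> are special on both sides, hence the complexity grows by at least 1 at every step.  If
  \<open>l \<le> r\<close>, the prefixes of \<open>V\<close> of lengths \<open>l < n \<le> |V|\<close> are further left special words; if
  \<open>r < l\<close>, the same holds for suffixes and right special words.  Summing up, the complexity of \<open>d\<close> at
  \<open>n = |V| + 1\<close> is at least \<open>n + |V| - min l r\<close>, and \<open>min l r < (|V| - C) / 2\<close> makes this at least
  \<open>(3n + C) / 2\<close>.
\<close>

section \<open>Factors of a sequence\<close>

definition factor :: "(int \<Rightarrow> 'b) \<Rightarrow> int \<Rightarrow> nat \<Rightarrow> 'b list" where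
  "factor x k n = map (\<lambda>j. x (k + int j)) [0..<n]"

lemma length_factor [simp]: "length (factor x k n) = n"
  by (simp add: factor_def)

lemma factor_0 [simp]: "factor x k 0 = []"
  by (simp add: factor_def)

lemma factor_eq_iff: "factor x k n = factor z l n \<longleftrightarrow> (\<forall>t<n. x (k + int t) = z (l + int t))"
  by (auto simp: factor_def list_eq_iff_nth_eq)

lemma factor_eq_iff_int:
  "factor x k n = factor z l n \<longleftrightarrow> (\<forall>t. 0 \<le> t \<and> t < int n \<longrightarrow> x (k + t) = z (l + t))"
  unfolding factor_eq_iff
  by (metis nat_0_le nat_less_iff of_nat_0_le_iff of_nat_less_iff)

lemma words_eq_factors: "words X n = {factor x k n | x k. x \<in> X}"
  by (simp add: words_def factor_def)

lemma words_single: "words {x} n = range (\<lambda>k. factor x k n)"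
  by (auto simp: words_eq_factors)

lemma finite_factors:
  assumes "finite (range x)"
  shows "finite ((\<lambda>k. factor x k n) ` S)"
proof (rule finite_subset)
  show "(\<lambda>k. factor x k n) ` S \<subseteq> {xs. set xs \<subseteq> range x \<and> length xs = n}"
    by (auto simp: factor_def)
  show "finite {xs. set xs \<subseteq> range x \<and> length xs = n}"
    using assms by (rule finite_lists_length_eq)
qed

lemma finite_words_single: "finite (range x) \<Longrightarrow> finite (words {x} n)"
  by (simp add: words_single finite_factors)

lemma factor_Suc: "factor x k (Suc n) = factor x k n @ [x (k + int n)]"
  by (simp add: factor_def)

lemma butlast_factor: "butlast (factor x k (Suc n)) = factor x k n"
  by (simp add: factor_Suc)

lemma tl_factor: "tl (factor x k (Suc n)) = factor x (k + 1) n"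
  by (auto simp: factor_def list_eq_iff_nth_eq nth_tl algebra_simps simp del: upt_Suc)

lemma factor_sub:
  assumes "factor x k n = factor z l n" "0 \<le> i" "i + int m \<le> int n"
  shows "factor x (k + i) m = factor z (l + i) m"
  unfolding factor_eq_iff_int
proof (intro allI impI)
  fix t :: int assume "0 \<le> t \<and> t < int m"
  then have "x (k + (i + t)) = z (l + (i + t))"
    using assms unfolding factor_eq_iff_int by simp
  then show "x (k + i + t) = z (l + i + t)" by (simp add: add.assoc)
qed

section \<open>Eventual periodicity and the Morse--Hedlund bound\<close>

definition eventually_periodic :: "(int \<Rightarrow> 'b) \<Rightarrow> bool" where
  "eventually_periodic x \<longleftrightarrow> (\<exists>N q. q > 0 \<and> (\<forall>i\<ge>N. x (i + q) = x i))"

lemma periodic_mult: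
  fixes x :: "int \<Rightarrow> 'b"
  assumes "\<And>i. i \<ge> N \<Longrightarrow> x (i + q) = x i" "q \<ge> 0" "i \<ge> N"
  shows "x (i + int k * q) = x i"
proof (induction k)
  case (Suc k)
  have "i + int k * q \<ge> N"
    using assms by (simp add: add_increasing2)
  from assms(1)[OF this] Suc show ?case
    by (simp add: algebra_simps)
qed simp

text \<open>If the number of factors starting in \<open>S\<close> stops growing at length \<open>k\<close>, then a factor of
  length \<open>k\<close> determines the next letter.  If there are \<open>m\<close> such factors, one of them repeats among any
  \<open>m + 1\<close> consecutive positions, which gives a period of at most \<open>m\<close> from there on.  Passing to the
  common period \<open>m!\<close> makes the period independent of the position, so that the same lemma serves half-lines and the whole line.\<close>

lemma morse_hedlund:
  fixes x :: "int \<Rightarrow> 'b"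
  assumes fin: "finite (range x)"
    and up: "\<And>i j. i \<in> S \<Longrightarrow> i \<le> j \<Longrightarrow> j \<in> S" and ne: "S \<noteq> {}"
    and small: "card ((\<lambda>k. factor x k n) ` S) \<le> n"
  shows "\<exists>M q. q > 0 \<and> (\<forall>i\<in>S. x (i + M + q) = x (i + M))"
proof -
  let ?W = "\<lambda>n. (\<lambda>k. factor x k n) ` S"
  have W0: "card (?W 0) = 1"
    using ne by (simp add: image_constant_conv)
  have butl: "butlast ` ?W (Suc k) = ?W k" for k
    by (simp add: image_image butlast_factor)
  have "\<exists>k<n. card (?W (Suc k)) \<le> card (?W k)"
  proof (rule ccontr)
    assume "\<not> ?thesis"
    then have inc: "card (?W k) < card (?W (Suc k))" if "k < n" for k
      using that by (auto simp: not_le)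
    have "k \<le> n \<Longrightarrow> card (?W k) \<ge> k + 1" for k
    proof (induction k)
      case (Suc k)
      then show ?case using inc[of k] by simp
    qed (use W0 in simp)
    from this[of n] small show False by simp
  qed
  then obtain k where k: "card (?W (Suc k)) \<le> card (?W k)" by blast
  have "inj_on butlast (?W (Suc k))"
  proof (rule eq_card_imp_inj_on)
    show "finite (?W (Suc k))" by (rule finite_factors[OF fin])
    then show "card (butlast ` ?W (Suc k)) = card (?W (Suc k))"
      using k card_image_le[of "?W (Suc k)" butlast] by (simp add: butl)
  qed
  then have det: "factor x i (Suc k) = factor x j (Suc k)"
    if "i \<in> S" "j \<in> S" "factor x i k = factor x j k" for i j
    by (rule inj_onD) (use that in \<open>simp_all add: butlast_factor\<close>)
  have step: "factor x (i + 1) k = factor x (j + 1) k"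
    if "i \<in> S" "j \<in> S" "factor x i k = factor x j k" for i j
    using det[OF that] by (metis tl_factor)
  have persist: "factor x (i + int t) k = factor x (j + int t) k"
    if "i \<in> S" "j \<in> S" "factor x i k = factor x j k" for i j t
  proof (induction t)
    case (Suc t)
    have "i + int t \<in> S" "j + int t \<in> S"
      using that up by auto
    from step[OF this Suc] show ?case by (simp add: algebra_simps)
  qed (use that in simp)
  have letter: "x (i + int k + int t) = x (j + int k + int t)"
    if "i \<in> S" "j \<in> S" "factor x i k = factor x j k" for i j t
  proof -
    have "i + int t \<in> S" "j + int t \<in> S"
      using that up by auto
    from det[OF this persist[OF that]]
    have "x (i + int t + int k) = x (j + int t + int k)"
      by (simp add: factor_Suc)
    then show ?thesis by (simp add: algebra_simps)
  qed
  define m where "m = card (?W k)"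
  define q where "q = int (fact m)"
  have finW: "finite (?W k)" by (rule finite_factors[OF fin])
  have "x (i + (int m + int k) + q) = x (i + (int m + int k))" if i: "i \<in> S" for i
  proof -
    have sub: "(\<lambda>t. factor x (i + int t) k) ` {..m} \<subseteq> ?W k"
      using i up by auto
    have "\<not> inj_on (\<lambda>t. factor x (i + int t) k) {..m}"
      using card_inj_on_le[OF _ sub finW] by (auto simp: m_def)
    then obtain a b where ab: "a < b" "b \<le> m" "factor x (i + int a) k = factor x (i + int b) k"
      unfolding inj_on_def by (metis atMost_iff linorder_neqE_nat)
    have abS: "i + int a \<in> S" "i + int b \<in> S" using i up by auto
    define r where "r = int (b - a)"
    have per: "x (j + r) = x j" if "j \<ge> i + int a + int k" for j
    proof -
      from that obtain t where t: "j = i + int a + int k + int t"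
        using zle_iff_zadd by auto
      show ?thesis
        using letter[OF abS ab(3), of t] ab(1) by (simp add: t r_def algebra_simps of_nat_diff)
    qed
    have "b - a dvd fact m"
      using ab by (intro dvd_fact) auto
    then obtain c where c: "fact m = (b - a) * c" by (rule dvdE)
    have "x (i + (int m + int k) + int c * r) = x (i + (int m + int k))"
      by (rule periodic_mult[where N = "i + int a + int k"]) (use per ab in \<open>auto simp: r_def\<close>)
    moreover have "int c * r = q"
      unfolding q_def c r_def by (simp add: mult.commute)
    ultimately show ?thesis by simp
  qed
  moreover have "q > 0" by (simp add: q_def)
  ultimately show ?thesis by blast
qed

lemma aperiodic_factors:
  fixes y :: "int \<Rightarrow> 'b"
  assumes "finite (range y)" "\<And>q. q > 0 \<Longrightarrow> \<exists>i. y (i + q) \<noteq> y i"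
  shows "card (words {y} n) \<ge> n + 1"
proof (rule ccontr)
  assume "\<not> ?thesis"
  then have "card ((\<lambda>k. factor y k n) ` UNIV) \<le> n"
    by (simp add: words_single)
  from morse_hedlund[OF assms(1) _ _ this]
  obtain M q where q: "q > 0" "\<And>i. y (i + M + q) = y (i + M)" by auto
  have "y (i + q) = y i" for i
    using q(2)[of "i - M"] by simp
  with assms(2)[OF q(1)] show False by blast
qed

lemma ray_factors:
  fixes x :: "int \<Rightarrow> 'b"
  assumes "finite (range x)" "\<not> eventually_periodic x"
  shows "card ((\<lambda>k. factor x k n) ` {N..}) \<ge> n + 1"
proof (rule ccontr)
  assume "\<not> ?thesis"
  then have "card ((\<lambda>k. factor x k n) ` {N..}) \<le> n" by simp
  from morse_hedlund[OF assms(1) _ _ this]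
  obtain M q where q: "q > 0" "\<And>i. i \<ge> N \<Longrightarrow> x (i + M + q) = x (i + M)" by auto
  have "x (i + q) = x i" if "i \<ge> N + M" for i
    using q(2)[of "i - M"] that by simp
  with q(1) assms(2) show False
    unfolding eventually_periodic_def by blast
qed

lemma factor_periodic_reduce:
  fixes x :: "int \<Rightarrow> 'b"
  assumes "q > 0" "\<And>i. i \<ge> N \<Longrightarrow> x (i + q) = x i" "k \<ge> N"
  shows "factor x k n = factor x (N + (k - N) mod q) n"
proof -
  define c where "c = nat ((k - N) div q)"
  have "k = N + (k - N) mod q + int c * q"
    using assms(1,3) by (simp add: c_def pos_imp_zdiv_nonneg_iff)
  moreover have "x (N + (k - N) mod q + int t + int c * q) = x (N + (k - N) mod q + int t)" for t
    by (rule periodic_mult[where N = N]) (use assms in auto)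
  ultimately show ?thesis
    unfolding factor_eq_iff by (metis add.assoc add.commute)
qed

lemma factor_reflect: "factor (\<lambda>i. x (- i)) k n = rev (factor x (1 - k - int n) n)"
  by (auto simp: factor_def list_eq_iff_nth_eq rev_nth of_nat_diff algebra_simps intro!: arg_cong[of _ _ x])

lemma card_words_reflect: "card (words {\<lambda>i. x (- i)} n) = card (words {x} n)"
proof -
  have "words {\<lambda>i. x (- i)} n = rev ` words {x} n"
    unfolding words_single factor_reflect image_image
  proof (rule set_eqI, rule iffI)
    fix u assume "u \<in> range (\<lambda>k. rev (factor x (1 - k - int n) n))"
    then show "u \<in> range (\<lambda>k. rev (factor x k n))" by auto
  next
    fix u assume "u \<in> range (\<lambda>k. rev (factor x k n))"
    then obtain k where "u = rev (factor x (1 - (1 - k - int n) - int n) n)" by auto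
    then show "u \<in> range (\<lambda>k. rev (factor x (1 - k - int n) n))" by blast
  qed
  then show ?thesis by (simp add: card_image)
qed

text \<open>Away from a fixed middle part, a factor can be moved by a multiple of
  the period towards the middle, so all factors of length \<open>n\<close> start in a window of
  \<open>n + O(1)\<close> positions.\<close>

lemma eventually_periodic_complexity:
  fixes x :: "int \<Rightarrow> 'b"
  assumes "eventually_periodic x" "eventually_periodic (\<lambda>i. x (- i))"
  shows "\<exists>M. \<forall>n. card (words {x} n) \<le> n + M"
proof -
  obtain N q where q: "q > 0" "\<And>i. i \<ge> N \<Longrightarrow> x (i + q) = x i"
    using assms(1) unfolding eventually_periodic_def by blast
  obtain N' q' where q': "q' > 0" "\<And>i. i \<ge> N' \<Longrightarrow> x (- (i + q')) = x (- i)"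
    using assms(2) unfolding eventually_periodic_def by blast
  let ?z = "\<lambda>i. x (- i)"
  have "card (words {x} n) \<le> n + (nat q + nat q' + nat (\<bar>N\<bar> + \<bar>N'\<bar>))" for n
  proof -
    let ?F = "\<lambda>k. factor x k n"
    let ?R = "{N..<N + q}" and ?L = "{1 - N' - int n - q'<..1 - N' - int n}"
      and ?C = "{1 - N' - int n<..<N}"
    have "?F k \<in> ?F ` ?R \<union> ?F ` ?L \<union> ?F ` ?C" for k
    proof -
      consider "k \<ge> N" | "1 - k - int n \<ge> N'" | "k < N" "1 - k - int n < N'" by linarith
      then show ?thesis
      proof cases
        case 1
        have "?F k = ?F (N + (k - N) mod q)"
          by (rule factor_periodic_reduce) (use q 1 in auto)
        moreover have "N + (k - N) mod q \<in> ?R" using q(1) by simp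
        ultimately show ?thesis by blast
      next
        case 2
        define i where "i = (1 - k - int n - N') mod q'"
        have i: "0 \<le> i" "i < q'" using q'(1) by (auto simp: i_def)
        have "factor ?z (1 - k - int n) n = factor ?z (N' + i) n"
          unfolding i_def by (rule factor_periodic_reduce) (use q' 2 in auto)
        then have "?F k = ?F (1 - (N' + i) - int n)"
          by (simp add: factor_reflect)
        moreover have "1 - (N' + i) - int n \<in> ?L" using i by auto
        ultimately show ?thesis by blast
      next
        case 3
        then have "k \<in> ?C" by auto
        then show ?thesis by blast
      qed
    qed
    then have "words {x} n \<subseteq> ?F ` ?R \<union> ?F ` ?L \<union> ?F ` ?C"
      unfolding words_single by blast
    then have "card (words {x} n) \<le> card (?F ` ?R \<union> ?F ` ?L \<union> ?F ` ?C)"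
      by (intro card_mono) auto
    also have "\<dots> \<le> card (?F ` ?R) + card (?F ` ?L) + card (?F ` ?C)"
      by (meson add_le_mono card_Un_le le_refl le_trans)
    also have "\<dots> \<le> card ?R + card ?L + card ?C"
      by (intro add_mono card_image_le) auto
    also have "\<dots> \<le> n + (nat q + nat q' + nat (\<bar>N\<bar> + \<bar>N'\<bar>))"
      by (simp add: algebra_simps)
    finally show ?thesis .
  qed
  then show ?thesis by blast
qed

section \<open>Counting factors by a marker word\<close>

text \<open>Call a factor free if it does not contain the word \<open>w\<close>.  Some occurrence of \<open>w\<close> has
  a long free stretch on one side; sliding a window of length \<open>n\<close> over it produces factors that
  are told apart by the position of the first (or last) \<open>w\<close>.  Hence there are at least
  \<open>n - |w|\<close> factors that are not free.\<close>

lemma complexity_with_marker: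
  fixes x :: "int \<Rightarrow> 'b"
  assumes fin: "finite (range x)" and occ: "factor x k0 m = w"
    and free: "\<And>n. n + 1 \<le> card {factor x k n | k.
                 \<forall>j. k \<le> j \<and> j + int m \<le> k + int n \<longrightarrow> factor x j m \<noteq> w}"
  shows "2 * n \<le> card (words {x} n) + m"
proof -
  define G where "G n = {factor x k n | k.
                 \<forall>j. k \<le> j \<and> j + int m \<le> k + int n \<longrightarrow> factor x j m \<noteq> w}" for n
  have free: "n + 1 \<le> card (G n)" for n
    using free by (simp add: G_def)
  have G_sub: "G n \<subseteq> words {x} n"
    by (auto simp: G_def words_single)
  have finW: "finite (words {x} n)" by (rule finite_words_single[OF fin])
  show ?thesis
  proof (cases "n < m")
    case True
    then show ?thesis using free[of n] card_mono[OF finW G_sub] by linarith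
  next
    case False
    have "G (n + m) \<noteq> {}" using free[of "n + m"] by auto
    then obtain k where k: "\<And>j. k \<le> j \<Longrightarrow> j \<le> k + int n \<Longrightarrow> factor x j m \<noteq> w"
      by (auto simp: G_def)
    obtain j0 where j0: "factor x j0 m = w"
      and side: "(\<forall>j. j0 - int n \<le> j \<and> j < j0 \<longrightarrow> factor x j m \<noteq> w) \<or>
                 (\<forall>j. j0 < j \<and> j \<le> j0 + int n \<longrightarrow> factor x j m \<noteq> w)"
    proof (cases "k0 \<ge> k")
      case True
      define t where "t = (LEAST t. factor x (k + int t) m = w)"
      have "factor x (k + int (nat (k0 - k))) m = w" using True occ by simp
      then have t: "factor x (k + int t) m = w" unfolding t_def by (rule LeastI)
      have first: "factor x j m \<noteq> w" if "k \<le> j" "j < k + int t" for j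
        using not_less_Least[of "nat (j - k)" "\<lambda>t. factor x (k + int t) m = w"] that
        by (auto simp: t_def[symmetric] nat_less_iff)
      have "t > n" using k[of "k + int t"] t by force
      with t first show thesis
        by (intro that[of "k + int t"]) auto
    next
      case False
      define t where "t = (LEAST t. factor x (k - int t) m = w)"
      have "factor x (k - int (nat (k - k0))) m = w" using False occ by simp
      then have t: "factor x (k - int t) m = w" unfolding t_def by (rule LeastI)
      have last: "factor x j m \<noteq> w" if "k - int t < j" "j \<le> k" for j
        using not_less_Least[of "nat (k - j)" "\<lambda>t. factor x (k - int t) m = w"] that
        by (auto simp: t_def[symmetric] nat_less_iff)
      have "factor x j m \<noteq> w" if "k - int t < j" "j \<le> k - int t + int n" for j
        using last[of j] k[of j] that by (cases "j \<le> k") auto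
      with t show thesis
        by (intro that[of "k - int t"]) auto
    qed
    let ?H = "(\<lambda>i. factor x (j0 - int i) n) ` {..n - m}"
    have neq: "factor x (j0 - int i) n \<noteq> factor x (j0 - int i') n"
      if "i < i'" "i' \<le> n - m" for i i'
    proof
      assume eq: "factor x (j0 - int i) n = factor x (j0 - int i') n"
      have "factor x (j0 - int i + int i) m = factor x (j0 - int i' + int i) m"
        by (rule factor_sub[OF eq]) (use that False in auto)
      moreover have "factor x (j0 - int i + int i') m = factor x (j0 - int i' + int i') m"
        by (rule factor_sub[OF eq]) (use that False in auto)
      ultimately have "factor x (j0 - int i' + int i) m = w" "factor x (j0 - int i + int i') m = w"
        using j0 by auto
      moreover have "j0 - int n \<le> j0 - int i' + int i" "j0 - int i' + int i < j0"
        "j0 < j0 - int i + int i'" "j0 - int i + int i' \<le> j0 + int n"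
        using that by linarith+
      ultimately show False using side by blast
    qed
    have "inj_on (\<lambda>i. factor x (j0 - int i) n) {..n - m}"
    proof (rule inj_onI)
      fix i i' assume "i \<in> {..n - m}" "i' \<in> {..n - m}"
        "factor x (j0 - int i) n = factor x (j0 - int i') n"
      then show "i = i'"
        using neq[of i i'] neq[of i' i] by (cases i i' rule: linorder_cases) auto
    qed
    then have cardH: "card ?H = n - m + 1" by (simp add: card_image)
    have "?H \<inter> G n = {}"
    proof (rule ccontr)
      assume "\<not> ?thesis"
      then obtain i k where i: "i \<le> n - m" and eq: "factor x (j0 - int i) n = factor x k n"
        and fr: "\<And>j. k \<le> j \<Longrightarrow> j + int m \<le> k + int n \<Longrightarrow> factor x j m \<noteq> w"
        by (auto simp: G_def)
      have "factor x (j0 - int i + int i) m = factor x (k + int i) m"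
        by (rule factor_sub[OF eq]) (use i False in auto)
      moreover have "k \<le> k + int i" "k + int i + int m \<le> k + int n" using i False by auto
      ultimately show False using j0 fr[of "k + int i"] by simp
    qed
    then have "card ?H + card (G n) = card (?H \<union> G n)"
      by (intro card_Un_disjoint[symmetric] finite_subset[OF G_sub finW]) auto
    also have "\<dots> \<le> card (words {x} n)"
      using G_sub by (intro card_mono[OF finW]) (auto simp: words_single)
    finally show ?thesis using cardH free[of n] False by linarith
  qed
qed

section \<open>Special factors\<close>

text \<open>With \<open>f\<close> deleting the first or last letter, this turns special words of length \<open>n\<close> into extra
  words of length \<open>n + 1\<close>.\<close>

lemma card_double_fibres:
  assumes "finite U" "f ` U = W" "S \<subseteq> W"
    and two: "\<And>s. s \<in> S \<Longrightarrow> \<exists>a\<in>U. \<exists>b\<in>U. a \<noteq> b \<and> f a = s \<and> f b = s"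
  shows "card W + card S \<le> card U"
proof -
  have "\<forall>w\<in>W. \<exists>a. a \<in> U \<and> f a = w"
    using assms(2) by auto
  then obtain g where g: "\<And>w. w \<in> W \<Longrightarrow> g w \<in> U \<and> f (g w) = w"
    unfolding bchoice_iff by blast
  have "\<forall>s\<in>S. \<exists>c. c \<in> U \<and> c \<noteq> g s \<and> f c = s"
    using two by metis
  then obtain h where h: "\<And>s. s \<in> S \<Longrightarrow> h s \<in> U \<and> h s \<noteq> g s \<and> f (h s) = s"
    unfolding bchoice_iff by blast
  have finW: "finite W" using assms(1,2) by blast
  have finS: "finite S" using assms(3) finW by (rule finite_subset)
  have "card W + card S = card (g ` W) + card (h ` S)"
    using g h by (auto intro!: arg_cong2[of _ _ _ _ "(+)"] card_image[symmetric] inj_on_inverseI[of _ f])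
  also have "\<dots> = card (g ` W \<union> h ` S)"
  proof (rule card_Un_disjoint[symmetric])
    show "g ` W \<inter> h ` S = {}"
    proof (rule ccontr)
      assume "g ` W \<inter> h ` S \<noteq> {}"
      then obtain w s where ws: "w \<in> W" "s \<in> S" "g w = h s" by auto
      then have "w = s" using g[of w] h[of s] by metis
      with ws h show False by metis
    qed
  qed (use finW finS in auto)
  also have "\<dots> \<le> card U"
    using g h assms(3) by (intro card_mono[OF assms(1)]) auto
  finally show ?thesis .
qed

definition left_special :: "(int \<Rightarrow> 'b) \<Rightarrow> 'b list \<Rightarrow> bool" where
  "left_special x u \<longleftrightarrow> (\<exists>s t. factor x s (length u) = u \<and> factor x t (length u) = u \<and>
      x (s - 1) \<noteq> x (t - 1))"

definition right_special :: "(int \<Rightarrow> 'b) \<Rightarrow> 'b list \<Rightarrow> bool" where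
  "right_special x u \<longleftrightarrow> (\<exists>s t. factor x s (length u) = u \<and> factor x t (length u) = u \<and>
      x (s + int (length u)) \<noteq> x (t + int (length u)))"

lemma left_special_growth:
  assumes fin: "finite (range x)" and S: "\<And>u. u \<in> S \<Longrightarrow> length u = n \<and> left_special x u"
  shows "card (words {x} n) + card S \<le> card (words {x} (Suc n))"
proof (rule card_double_fibres[where f = tl])
  show "finite (words {x} (Suc n))" by (rule finite_words_single[OF fin])
  have "factor x k n \<in> tl ` words {x} (Suc n)" for k
    using tl_factor[of x "k - 1" n] by (simp add: words_single image_image) (metis rangeI)
  then show "tl ` words {x} (Suc n) = words {x} n"
    by (auto simp: words_single tl_factor)
  show "S \<subseteq> words {x} n"
    using S unfolding words_single left_special_def by (metis rangeI subsetI)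
next
  fix u assume "u \<in> S"
  with S obtain s t where st: "factor x s n = u" "factor x t n = u" "x (s - 1) \<noteq> x (t - 1)"
    unfolding left_special_def by metis
  then have "factor x (s - 1) (Suc n) \<noteq> factor x (t - 1) (Suc n)"
    unfolding factor_eq_iff by force
  then show "\<exists>a\<in>words {x} (Suc n). \<exists>b\<in>words {x} (Suc n). a \<noteq> b \<and> tl a = u \<and> tl b = u"
    using st by (intro bexI conjI) (auto simp: words_single tl_factor)
qed

lemma right_special_growth:
  assumes fin: "finite (range x)" and S: "\<And>u. u \<in> S \<Longrightarrow> length u = n \<and> right_special x u"
  shows "card (words {x} n) + card S \<le> card (words {x} (Suc n))"
proof (rule card_double_fibres[where f = butlast])
  show "finite (words {x} (Suc n))" by (rule finite_words_single[OF fin])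
  show "butlast ` words {x} (Suc n) = words {x} n"
    by (simp add: words_single image_image butlast_factor)
  show "S \<subseteq> words {x} n"
    using S unfolding words_single right_special_def by (metis rangeI subsetI)
next
  fix u assume "u \<in> S"
  with S obtain s t where st: "factor x s n = u" "factor x t n = u" "x (s + int n) \<noteq> x (t + int n)"
    unfolding right_special_def by metis
  then have "factor x s (Suc n) \<noteq> factor x t (Suc n)"
    by (simp add: factor_Suc)
  then show "\<exists>a\<in>words {x} (Suc n). \<exists>b\<in>words {x} (Suc n). a \<noteq> b \<and> butlast a = u \<and> butlast b = u"
    using st by (intro bexI conjI) (auto simp: words_single butlast_factor)
qed

lemma double_growth_sum:
  fixes c :: "nat \<Rightarrow> nat"
  assumes "\<And>n. c n + 1 \<le> c (Suc n)" "\<And>n. l < n \<Longrightarrow> n \<le> v \<Longrightarrow> c n + 2 \<le> c (Suc n)"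
  shows "Suc v + (v - l) \<le> c (Suc v)"
proof -
  have "n \<le> Suc v \<Longrightarrow> n + (n - Suc l) \<le> c n" for n
  proof (induction n)
    case (Suc n)
    then show ?case using assms[of n] by (cases "l < n") auto
  qed simp
  from this[of "Suc v"] show ?thesis by simp
qed

text \<open>The same parameter \<open>C\<close> bounds the length and the excess over \<open>3n/2\<close>, so that such lengths
  \<open>n\<close> exist beyond any point from which an upper bound is assumed.\<close>

definition unbounded_excess :: "(int \<Rightarrow> 'b) \<Rightarrow> bool" where
  "unbounded_excess x \<longleftrightarrow> (\<forall>C. \<exists>n\<ge>C. 3 * n + C \<le> 2 * card (words {x} n))"

lemma unbounded_excess_linear:
  assumes "\<And>n. 2 * n \<le> card (words {x} n) + m"
  shows "unbounded_excess x"
  unfolding unbounded_excess_def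
proof
  fix C
  show "\<exists>n\<ge>C. 3 * n + C \<le> 2 * card (words {x} n)"
    using assms[of "C + 2 * m"] by (intro exI[of _ "C + 2 * m"] conjI) auto
qed

section \<open>Sequences with long runs of zeros\<close>

lemma factor_eq_replicate:
  "factor d s n = replicate n c \<longleftrightarrow> (\<forall>t. 0 \<le> t \<and> t < int n \<longrightarrow> d (s + t) = c)"
proof -
  have "factor d s n = replicate n c \<longleftrightarrow> (\<forall>t<n. d (s + int t) = c)"
    by (auto simp: factor_def list_eq_iff_nth_eq)
  then show ?thesis
    by (metis nat_0_le nat_less_iff of_nat_0_le_iff of_nat_less_iff)
qed

lemma first_at_right:
  fixes i :: int
  assumes "P j" "i \<le> j"
  obtains k where "i \<le> k" "k \<le> j" "P k" "\<And>l. i \<le> l \<Longrightarrow> l < k \<Longrightarrow> \<not> P l"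
proof -
  define t where "t = (LEAST t. P (i + int t))"
  have j: "P (i + int (nat (j - i)))" using assms by simp
  have t: "P (i + int t)"
    unfolding t_def using LeastI[of "\<lambda>t. P (i + int t)", OF j] .
  have "t \<le> nat (j - i)"
    unfolding t_def using Least_le[of "\<lambda>t. P (i + int t)", OF j] .
  moreover have "\<not> P l" if "i \<le> l" "l < i + int t" for l
    using not_less_Least[of "nat (l - i)" "\<lambda>t. P (i + int t)"] that
    by (auto simp: t_def[symmetric] nat_less_iff)
  ultimately show thesis
    using t assms(2) by (intro that[of "i + int t"]) auto
qed

lemma first_at_left:
  fixes i :: int
  assumes "P j" "j \<le> i"
  obtains k where "k \<le> i" "j \<le> k" "P k" "\<And>l. k < l \<Longrightarrow> l \<le> i \<Longrightarrow> \<not> P l"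
proof -
  have "P (- (- j))" using assms(1) by simp
  then obtain k where k: "- i \<le> k" "k \<le> - j" "P (- k)" "\<And>l. - i \<le> l \<Longrightarrow> l < k \<Longrightarrow> \<not> P (- l)"
    using first_at_right[of "\<lambda>l. P (- l)" "- j" "- i"] assms(2) by auto
  have "\<not> P l" if "- k < l" "l \<le> i" for l
    using k(4)[of "- l"] that by simp
  with k show thesis by (intro that[of "- k"]) auto
qed

locale recurrent_zero_runs =
  fixes d :: "int \<Rightarrow> 'b::zero" and a :: int
  assumes fin: "finite (range d)"
    and aper: "\<not> eventually_periodic d"
    and rec: "\<And>k n N. \<exists>j\<ge>N. factor d j n = factor d k n"
    and zeros: "\<And>n. \<exists>k. factor d k n = replicate n 0"
    and nz: "d a \<noteq> 0"
begin

lemma nonzero_right: "\<exists>j\<ge>N. d j \<noteq> 0"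
  using rec[of N 1 a] nz by (auto simp: factor_def)

lemma zero_word_right_special: "right_special d (replicate n 0)"
proof -
  obtain k where k: "\<And>t. 0 \<le> t \<Longrightarrow> t < int (Suc n) \<Longrightarrow> d (k + t) = 0"
    using zeros[of "Suc n"] unfolding factor_eq_replicate by blast
  obtain j where "j \<ge> k" "d j \<noteq> 0" using nonzero_right by blast
  then obtain e where e: "k \<le> e" "d e \<noteq> 0" "\<And>l. k \<le> l \<Longrightarrow> l < e \<Longrightarrow> d l = 0"
    using first_at_right[of "\<lambda>l. d l \<noteq> 0" j k] by metis
  have "e - k > int n"
    using k[of "e - k"] e by force
  then have "factor d (e - int n) n = replicate n 0"
    unfolding factor_eq_replicate by (auto intro!: e(3))
  moreover have "factor d k n = replicate n 0"
    unfolding factor_eq_replicate by (auto intro!: k)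
  moreover have "d (k + int n) = 0" by (rule k) auto
  ultimately show ?thesis
    unfolding right_special_def using e(2)
    by (intro exI[of _ k] exI[of _ "e - int n"]) auto
qed

lemma zero_word_left_special: "left_special d (replicate n 0)"
proof -
  obtain k0 where k0: "factor d k0 (Suc n) = replicate (Suc n) 0"
    using zeros by blast
  obtain k where "k \<ge> a" "factor d k (Suc n) = replicate (Suc n) 0"
    using rec[of a "Suc n" k0] k0 by auto
  then have k: "k \<ge> a" "\<And>t. 0 \<le> t \<Longrightarrow> t < int (Suc n) \<Longrightarrow> d (k + t) = 0"
    unfolding factor_eq_replicate by auto
  obtain e where e: "e \<le> k" "d e \<noteq> 0" "\<And>l. e < l \<Longrightarrow> l \<le> k \<Longrightarrow> d l = 0"
    using first_at_left[of "\<lambda>l. d l \<noteq> 0" a k] nz k(1) by metis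
  have zero: "d l = 0" if "e < l" "l \<le> k + int n" for l
    using e(3)[of l] k(2)[of "l - k"] that by (cases "l \<le> k") auto
  have "factor d (e + 1) n = replicate n 0"
    unfolding factor_eq_replicate using e(1) by (auto intro!: zero)
  moreover have "factor d (k + 1) n = replicate n 0"
    unfolding factor_eq_replicate using e(1) k(2)[of 0] e(2) by (auto intro!: zero)
  moreover have "d k = 0" using k(2)[of 0] by simp
  ultimately show ?thesis
    unfolding left_special_def using e(2)
    by (intro exI[of _ "e + 1"] exI[of _ "k + 1"]) auto
qed

text \<open>The longest word that surrounds every occurrence of \<open>w = d\<^sub>a \<dots> d\<^sub>b\<close>.  It is bounded:
  if all occurrences had the same right (left) continuation, two of them would give a period
  of a half-line (of all of \<open>d\<close>, since occurrences exist arbitrarily far to the right).\<close>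

lemma bispecial_extension:
  assumes "a \<le> b"
  obtains s e where "s \<le> a" "b < e"
    "\<And>n. s + int n \<le> e \<Longrightarrow> left_special d (factor d s n)"
    "\<And>n. s \<le> e - int n \<Longrightarrow> right_special d (factor d (e - int n) n)"
proof -
  define m where "m = nat (b - a + 1)"
  have m: "int m = b - a + 1" "m > 0" using assms by (auto simp: m_def)
  define P where "P = {p. factor d p m = factor d a m}"
  have aP: "a \<in> P" by (simp add: P_def)
  have P_right: "\<exists>p\<in>P. p \<ge> N" for N
    using rec[of N m a] by (auto simp: P_def)
  have P_agree: "d (p + t) = d (a + t)" if "p \<in> P" "0 \<le> t" "t < int m" for p t
    using that unfolding P_def factor_eq_iff_int by blast
  define R where "R t \<longleftrightarrow> (\<forall>p\<in>P. d (p + t) = d (a + t))" for t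
  have R_mid: "R t" if "0 \<le> t" "t < int m" for t
    using P_agree that by (simp add: R_def)
  obtain p1 where p1: "p1 \<in> P" "p1 \<ge> a + 1" using P_right by blast
  have "\<exists>t\<ge>0. \<not> R t"
  proof (rule ccontr)
    assume "\<not> ?thesis"
    then have per: "d (p1 + t) = d (a + t)" if "t \<ge> 0" for t
      using that p1(1) by (auto simp: R_def)
    have "d (i + (p1 - a)) = d i" if "i \<ge> a" for i
      using per[of "i - a"] that by (simp add: algebra_simps)
    then have "eventually_periodic d"
      unfolding eventually_periodic_def using p1(2) by (intro exI[of _ a] exI[of _ "p1 - a"]) auto
    with aper show False ..
  qed
  then obtain t0 where "0 \<le> t0" "\<not> R t0" by blast
  then obtain k where k: "0 \<le> k" "\<not> R k" "\<And>t. 0 \<le> t \<Longrightarrow> t < k \<Longrightarrow> R t"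
    using first_at_right[of "\<lambda>t. \<not> R t" t0 0] by metis
  have "\<exists>t\<le>-1. \<not> R t"
  proof (rule ccontr)
    assume "\<not> ?thesis"
    then have neg: "d (p + t) = d (a + t)" if "p \<in> P" "t < 0" for p t
      using that by (auto simp: R_def)
    have "d (i + (p1 - a)) = d i" for i
    proof -
      \<comment> \<open>Both \<open>i\<close> and \<open>i + (p1 - a)\<close> lie to the left of this occurrence.\<close>
      obtain p where p: "p \<in> P" "p \<ge> i + (p1 - a) + 1" using P_right by blast
      have "d i = d (a + (i - p))"
        using neg[of p "i - p"] p p1(2) by simp
      also have "\<dots> = d (p1 + (i - p))"
        using neg[OF p1(1), of "i - p"] p p1(2) by simp
      also have "\<dots> = d (p + (i + (p1 - a) - p))"
        using neg[OF p(1), of "i + (p1 - a) - p"] p(2) by (simp add: algebra_simps)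
      finally show ?thesis by simp
    qed
    then have "eventually_periodic d"
      unfolding eventually_periodic_def using p1(2) by (intro exI[of _ a] exI[of _ "p1 - a"]) auto
    with aper show False ..
  qed
  then obtain t1 where "t1 \<le> -1" "\<not> R t1" by blast
  then obtain j where j: "j \<le> -1" "\<not> R j" "\<And>t. j < t \<Longrightarrow> t \<le> -1 \<Longrightarrow> R t"
    using first_at_left[of "\<lambda>t. \<not> R t" t1 "-1"] by metis
  have R_all: "R t" if "j < t" "t < k" for t
    using j(3)[of t] k(3)[of t] that by (cases "t < 0") auto
  have km: "k \<ge> int m" using R_mid k(1,2) by (meson not_le)
  have same: "factor d (p + i) n = factor d (a + i) n"
    if "p \<in> P" "j < i" "i + int n \<le> k" for p i n
    unfolding factor_eq_iff_int
  proof (intro allI impI)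
    fix t assume "0 \<le> t \<and> t < int n"
    then have "R (i + t)" using that by (intro R_all) auto
    then show "d (p + i + t) = d (a + i + t)"
      using that(1) by (simp add: R_def add.assoc)
  qed
  define s where "s = a + j + 1"
  define e where "e = a + k"
  \<comment> \<open>At position \<open>j\<close> (or \<open>k\<close>) some occurrence disagrees with the one at \<open>a\<close>, while
    both carry the same letters strictly between \<open>j\<close> and \<open>k\<close>.\<close>
  obtain p2 where p2: "p2 \<in> P" "d (p2 + j) \<noteq> d (a + j)" using j(2) by (auto simp: R_def)
  obtain p3 where p3: "p3 \<in> P" "d (p3 + k) \<noteq> d (a + k)" using k(2) by (auto simp: R_def)
  have left: "left_special d (factor d s n)" if "s + int n \<le> e" for n
    unfolding left_special_def
    using same[OF p2(1), of "j + 1" n] p2(2) that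
    by (intro exI[of _ "p2 + (j + 1)"] exI[of _ s]) (simp add: s_def e_def algebra_simps)
  have right: "right_special d (factor d (e - int n) n)" if "s \<le> e - int n" for n
    unfolding right_special_def
    using same[OF p3(1), of "k - int n" n] p3(2) that
    by (intro exI[of _ "p3 + (k - int n)"] exI[of _ "e - int n"]) (simp add: s_def e_def algebra_simps)
  show thesis
  proof (rule that)
    show "s \<le> a" "b < e" using j(1) km m by (auto simp: s_def e_def)
  qed (use left right in auto)
qed

lemma growth_ge_1: "card (words {d} n) + 1 \<le> card (words {d} (Suc n))"
  using left_special_growth[OF fin, of "{replicate n 0}" n] zero_word_left_special by simp

lemma unbounded_excess: "unbounded_excess d"
  unfolding unbounded_excess_def
proof
  fix C :: nat
  let ?c = "\<lambda>n. card (words {d} n)"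
  obtain b where b: "b \<ge> a + int C" "d b \<noteq> 0" using nonzero_right by blast
  then have "a \<le> b" by simp
  then obtain s e where se: "s \<le> a" "b < e"
    and left: "\<And>n. s + int n \<le> e \<Longrightarrow> left_special d (factor d s n)"
    and right: "\<And>n. s \<le> e - int n \<Longrightarrow> right_special d (factor d (e - int n) n)"
    using bispecial_extension[of b] by metis
  define v where "v = nat (e - s)"
  have v: "int v = e - s" using se b by (simp add: v_def)
  obtain f where f: "s \<le> f" "f \<le> a" "d f \<noteq> 0" "\<And>l. s \<le> l \<Longrightarrow> l < f \<Longrightarrow> d l = 0"
    using first_at_right[of "\<lambda>l. d l \<noteq> 0" a s] nz se(1) by metis
  obtain g where g: "g \<le> e - 1" "b \<le> g" "d g \<noteq> 0"
    using first_at_left[of "\<lambda>l. d l \<noteq> 0" b "e - 1"] b se(2) by force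
  define l where "l = nat (f - s)"
  define r where "r = nat (e - 1 - g)"
  have lr: "int l = f - s" "int r = e - 1 - g" using f g by (auto simp: l_def r_def)
  have two_left: "?c n + 2 \<le> ?c (Suc n)" if "l < n" "n \<le> v" for n
  proof -
    have "\<not> (\<forall>t. 0 \<le> t \<and> t < int n \<longrightarrow> d (s + t) = 0)"
      using f lr that(1) by (auto intro!: exI[of _ "f - s"])
    then have "factor d s n \<noteq> replicate n 0"
      unfolding factor_eq_replicate .
    moreover have "left_special d (factor d s n)" using left that v by simp
    ultimately show ?thesis
      using left_special_growth[OF fin, of "{factor d s n, replicate n 0}" n] zero_word_left_special
      by fastforce
  qed
  have two_right: "?c n + 2 \<le> ?c (Suc n)" if "r < n" "n \<le> v" for n
  proof -
    have "\<not> (\<forall>t. 0 \<le> t \<and> t < int n \<longrightarrow> d (e - int n + t) = 0)"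
      using g lr that(1) by (auto intro!: exI[of _ "g - e + int n"])
    then have "factor d (e - int n) n \<noteq> replicate n 0"
      unfolding factor_eq_replicate .
    moreover have "right_special d (factor d (e - int n) n)" using right that v by simp
    ultimately show ?thesis
      using right_special_growth[OF fin, of "{factor d (e - int n) n, replicate n 0}" n]
        zero_word_right_special
      by fastforce
  qed
  have "Suc v + (v - min l r) \<le> ?c (Suc v)"
  proof (rule double_growth_sum)
    show "?c n + 2 \<le> ?c (Suc n)" if "min l r < n" "n \<le> v" for n
      using two_left[of n] two_right[of n] that by (cases "l \<le> r") auto
  qed (rule growth_ge_1)
  moreover have "v \<ge> l + r + C + 1"
    using v lr f g b by linarith
  ultimately have "3 * Suc v + C \<le> 2 * ?c (Suc v)" "C \<le> Suc v"
    by (auto simp: min_def split: if_splits)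
  then show "\<exists>n\<ge>C. 3 * n + C \<le> 2 * ?c n" by blast
qed

end

text \<open>A word that is missing from a right half-line serves as a marker: that half-line already
  supplies \<open>n + 1\<close> words without it.\<close>

lemma zero_runs_excess_right:
  fixes d :: "int \<Rightarrow> 'b::zero"
  assumes fin: "finite (range d)" and aper: "\<not> eventually_periodic d"
    and zeros: "\<And>n. \<exists>k. factor d k n = replicate n 0" and nz: "d a \<noteq> 0"
  shows "unbounded_excess d"
proof (cases "\<forall>k n N. \<exists>j\<ge>N. factor d j n = factor d k n")
  case True
  then interpret recurrent_zero_runs d a
    using assms by unfold_locales auto
  show ?thesis by (rule unbounded_excess)
next
  case False
  then obtain k0 m N where avoid: "\<And>j. j \<ge> N \<Longrightarrow> factor d j m \<noteq> factor d k0 m" by blast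
  have "n + 1 \<le> card {factor d k n | k. \<forall>j. k \<le> j \<and> j + int m \<le> k + int n \<longrightarrow>
      factor d j m \<noteq> factor d k0 m}" (is "_ \<le> card ?G") for n
  proof -
    have "n + 1 \<le> card ((\<lambda>k. factor d k n) ` {N..})"
      by (rule ray_factors[OF fin aper])
    also have "\<dots> \<le> card ?G"
    proof (rule card_mono)
      show "finite ?G"
        by (rule finite_subset[OF _ finite_words_single[OF fin, of n]]) (auto simp: words_single)
      show "(\<lambda>k. factor d k n) ` {N..} \<subseteq> ?G"
        using avoid by force
    qed
    finally show ?thesis .
  qed
  from complexity_with_marker[OF fin refl this] show ?thesis
    by (rule unbounded_excess_linear)
qed

lemma zero_runs_excess:
  fixes d :: "int \<Rightarrow> 'b::zero"
  assumes fin: "finite (range d)"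
    and aper: "\<not> (eventually_periodic d \<and> eventually_periodic (\<lambda>i. d (- i)))"
    and zeros: "\<And>n. \<exists>k. factor d k n = replicate n 0" and nz: "d a \<noteq> 0"
  shows "unbounded_excess d"
proof (cases "eventually_periodic d")
  case False
  then show ?thesis using zero_runs_excess_right fin zeros nz by blast
next
  case True
  let ?d = "\<lambda>i. d (- i)"
  have "unbounded_excess ?d"
  proof (rule zero_runs_excess_right)
    show "finite (range ?d)" by (rule finite_subset[OF _ fin]) auto
    show "\<not> eventually_periodic ?d" using aper True by simp
    show "?d (- a) \<noteq> 0" using nz by simp
    fix n
    obtain k where k: "factor d k n = replicate n 0" using zeros by blast
    have "factor ?d (1 - k - int n) n = rev (factor d k n)"
      by (simp add: factor_reflect)
    with k show "\<exists>k. factor ?d k n = replicate n 0" by (metis rev_replicate)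
  qed
  then show ?thesis
    by (simp add: unbounded_excess_def card_words_reflect)
qed

section \<open>Differences of a sequence\<close>

text \<open>If \<open>d\<close> has period \<open>q\<close>, then \<open>g(i + p q) - g(i)\<close> is \<open>q\<close>-periodic in \<open>i\<close>, so \<open>g\<close> grows
  by a fixed amount over each stretch of length \<open>p q\<close>; boundedness forces that amount to be 0.\<close>

lemma eventually_periodic_antidifference:
  fixes g :: "int \<Rightarrow> int"
  assumes fin: "finite (range g)" and p: "p > 0"
    and per: "eventually_periodic (\<lambda>i. g (i + p) - g i)"
  shows "eventually_periodic g"
proof -
  obtain N q where q: "q > 0" "\<And>i. i \<ge> N \<Longrightarrow> g (i + q + p) - g (i + q) = g (i + p) - g i"
    using per unfolding eventually_periodic_def by blast
  define Q where "Q = p * q"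
  have Q: "Q > 0" using p q(1) by (simp add: Q_def)
  define h where "h i = g (i + q) - g i" for i
  have h_per: "h (i + int k * p) = h i" if "i \<ge> N" for i k
    by (rule periodic_mult[where N = N]) (use q(2) p that in \<open>force simp: h_def algebra_simps\<close>)+
  have h_Q: "h (i + Q) = h i" if "i \<ge> N" for i
    using h_per[OF that, of "nat q"] q(1) by (simp add: Q_def mult.commute)
  define s where "s i = g (i + Q) - g i" for i
  have s_q: "s (i + q) = s i" if "i \<ge> N" for i
    using h_Q[OF that] by (simp add: s_def h_def algebra_simps)
  have s_Q: "s (i + int k * Q) = s i" if "i \<ge> N" for i k
  proof -
    have "s (i + int (k * nat p) * q) = s i"
      by (rule periodic_mult[where N = N]) (use s_q q(1) that in auto)
    then show ?thesis using p by (simp add: Q_def mult.assoc)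
  qed
  have sum: "g (i + int k * Q) = g i + int k * s i" if "i \<ge> N" for i k
  proof (induction k)
    case (Suc k)
    have "g (i + int (Suc k) * Q) = g (i + int k * Q) + s (i + int k * Q)"
      by (simp add: s_def algebra_simps)
    with Suc s_Q[OF that] show ?case by (simp add: algebra_simps)
  qed simp
  have "s i = 0" if "i \<ge> N" for i
  proof (rule ccontr)
    assume "s i \<noteq> 0"
    then have "inj (\<lambda>k. g (i + int k * Q))"
      by (auto simp: inj_on_def sum[OF that])
    moreover have "finite (range (\<lambda>k. g (i + int k * Q)))"
      by (rule finite_subset[OF _ fin]) auto
    ultimately show False using finite_imageD infinite_UNIV_nat by blast
  qed
  then show ?thesis
    unfolding eventually_periodic_def s_def using Q by (metis eq_iff_diff_eq_0)
qed

text \<open>Reflection turns a forward difference into a backward one, which costs a shift by \<open>p\<close>.\<close>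

lemma eventually_periodic_antidifference_left:
  fixes g :: "int \<Rightarrow> int"
  assumes fin: "finite (range g)" and p: "p > 0"
    and per: "eventually_periodic (\<lambda>i. g (- i + p) - g (- i))"
  shows "eventually_periodic (\<lambda>i. g (- i))"
proof (rule eventually_periodic_antidifference[OF _ p])
  show "finite (range (\<lambda>i. g (- i)))" by (rule finite_subset[OF _ fin]) auto
  obtain N q where q: "q > 0"
    "\<And>i. i \<ge> N \<Longrightarrow> g (- (i + q) + p) - g (- (i + q)) = g (- i + p) - g (- i)"
    using per unfolding eventually_periodic_def by blast
  have "g (- (i + q + p)) - g (- (i + q)) = g (- (i + p)) - g (- i)" if "i \<ge> N - p" for i
    using q(2)[of "i + p"] that by (simp add: algebra_simps)
  with q(1) show "eventually_periodic (\<lambda>i. g (- (i + p)) - g (- i))"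
    unfolding eventually_periodic_def by blast
qed

lemma eventually_periodic_comp_inj:
  assumes "inj_on f A" "range x \<subseteq> A" "eventually_periodic (\<lambda>i. f (x i))"
  shows "eventually_periodic x"
proof -
  have "x i \<in> A" for i using assms(2) by auto
  then show ?thesis
    using assms(3) inj_onD[OF assms(1)] unfolding eventually_periodic_def by metis
qed

text \<open>Differences at distance \<open>p\<close> turn every \<open>p\<close>-periodic stretch into zeros without regard to its
  phase, and a word of differences is a function of a word of \<open>x\<close> that is longer by \<open>p\<close>.\<close>

lemma periodic_factor_excess:
  fixes x :: "int \<Rightarrow> 'b"
  assumes fin: "finite (range x)" and p: "p > 0"
    and runs: "\<And>n. \<exists>k. \<forall>t. 0 \<le> t \<and> t < int n \<longrightarrow> x (k + t + p) = x (k + t)"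
    and aper: "\<not> (eventually_periodic x \<and> eventually_periodic (\<lambda>i. x (- i)))"
  shows "unbounded_excess x"
proof -
  obtain f :: "'b \<Rightarrow> nat" where "inj_on f (range x)"
    using finite_imp_inj_to_nat_seg[OF fin] by blast
  define f' where "f' b = int (f b)" for b
  have f': "inj_on f' (range x)"
    using \<open>inj_on f (range x)\<close> by (auto simp: inj_on_def f'_def)
  define g where "g i = f' (x i)" for i
  define d where "d i = g (i + p) - g i" for i
  have fin_g: "finite (range g)"
    unfolding g_def using finite_imageI[OF fin, of f'] by (simp add: image_image)
  have fin_d: "finite (range d)"
    by (rule finite_subset[of _ "(\<lambda>(a, b). a - b) ` (range g \<times> range g)"])
       (use fin_g in \<open>auto simp: d_def\<close>)
  define P where "P = nat p"
  have P: "int P = p" using p by (simp add: P_def)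
  have aper_d: "\<not> (eventually_periodic d \<and> eventually_periodic (\<lambda>i. d (- i)))"
  proof
    assume per: "eventually_periodic d \<and> eventually_periodic (\<lambda>i. d (- i))"
    have "eventually_periodic g"
      by (rule eventually_periodic_antidifference[OF fin_g p]) (use per in \<open>simp add: d_def[abs_def]\<close>)
    moreover have "eventually_periodic (\<lambda>i. g (- i))"
      by (rule eventually_periodic_antidifference_left[OF fin_g p]) (use per in \<open>simp add: d_def\<close>)
    ultimately have "eventually_periodic x" "eventually_periodic (\<lambda>i. x (- i))"
      unfolding g_def by (intro eventually_periodic_comp_inj[OF f']; auto)+
    with aper show False by blast
  qed
  have "\<exists>a. d a \<noteq> 0"
  proof (rule ccontr)
    assume "\<not> ?thesis"
    then have "d = (\<lambda>i. 0)" by auto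
    moreover have "eventually_periodic (\<lambda>i. 0 :: int)"
      by (auto simp: eventually_periodic_def intro: exI[of _ 1])
    ultimately show False using aper_d by simp
  qed
  then obtain a where a: "d a \<noteq> 0" by blast
  have "unbounded_excess d"
  proof (rule zero_runs_excess[OF fin_d aper_d _ a])
    fix n
    obtain k where "\<forall>t. 0 \<le> t \<and> t < int n \<longrightarrow> x (k + t + p) = x (k + t)"
      using runs by blast
    then have "factor d k n = replicate n 0"
      by (simp add: factor_eq_replicate d_def g_def)
    then show "\<exists>k. factor d k n = replicate n 0" by blast
  qed
  have le: "card (words {d} n) \<le> card (words {x} (n + P))" for n
  proof -
    define \<phi> where "\<phi> u = map (\<lambda>j. f' (u ! (j + P)) - f' (u ! j)) [0..<n]" for u
    have "factor d k n = \<phi> (factor x k (n + P))" for k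
      by (auto simp: factor_def \<phi>_def d_def g_def P[symmetric] add.assoc)
    then have "words {d} n = \<phi> ` words {x} (n + P)"
      by (simp add: words_single image_image)
    then show ?thesis
      by (simp add: card_image_le finite_words_single[OF fin])
  qed
  show ?thesis
    unfolding unbounded_excess_def
  proof
    fix C
    obtain n where n: "n \<ge> C + 3 * P" "3 * n + (C + 3 * P) \<le> 2 * card (words {d} n)"
      using \<open>unbounded_excess d\<close> unfolding unbounded_excess_def by blast
    then show "\<exists>n\<ge>C. 3 * n + C \<le> 2 * card (words {x} n)"
      using le[of n] by (intro exI[of _ "n + P"]) auto
  qed
qed

section \<open>Orbit closures\<close>

lemma closure_of_orbit:
  assumes "x \<in> topspace (full_shift A)"
  shows "z \<in> full_shift A closure_of orbit x \<longleftrightarrow>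
    z \<in> topspace (full_shift A) \<and> (\<forall>k n. \<exists>l. factor x l n = factor z k n)"
proof (intro iffI conjI allI)
  assume z: "z \<in> full_shift A closure_of orbit x"
  then show zt: "z \<in> topspace (full_shift A)" by (simp add: in_closure_of)
  fix k n
  define U where "U = {u \<in> topspace (full_shift A). \<forall>t<n. u (k + int t) = z (k + int t)}"
  have "openin (full_shift A) U"
    unfolding full_shift_def openin_product_topology_alt
  proof
    fix u assume u: "u \<in> U"
    define B where "B i = (if i \<in> (\<lambda>t. k + int t) ` {..<n} then {u i} else A)" for i
    have "finite {i. B i \<noteq> A}"
      by (rule finite_subset[of _ "(\<lambda>t. k + int t) ` {..<n}"]) (auto simp: B_def)
    moreover have "B i \<subseteq> A" for i
      using u by (auto simp: B_def U_def topspace_full_shift)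
    moreover have "u \<in> Pi\<^sub>E UNIV B"
      using u by (auto simp: B_def U_def topspace_full_shift)
    moreover have "Pi\<^sub>E UNIV B \<subseteq> U"
    proof
      fix v assume "v \<in> Pi\<^sub>E UNIV B"
      then have v: "v i \<in> B i" for i by auto
      have "v (k + int t) = u (k + int t)" if "t < n" for t
        using v[of "k + int t"] that by (auto simp: B_def)
      moreover have "v i \<in> A" for i using v \<open>\<And>i. B i \<subseteq> A\<close> by blast
      ultimately show "v \<in> U" using u by (auto simp: U_def topspace_full_shift)
    qed
    ultimately show "\<exists>B. finite {i \<in> UNIV. B i \<noteq> topspace (discrete_topology A)} \<and>
        (\<forall>i\<in>UNIV. openin (discrete_topology A) (B i)) \<and> u \<in> Pi\<^sub>E UNIV B \<and> Pi\<^sub>E UNIV B \<subseteq> U"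
      by (intro exI[of _ B]) simp
  qed
  moreover have "z \<in> U" using zt by (simp add: U_def)
  ultimately obtain u where "u \<in> orbit x" "u \<in> U"
    using z by (meson in_closure_of)
  then obtain m where "\<forall>t<n. x (k + int t + m) = z (k + int t)"
    by (auto simp: orbit_def shift_pow_def U_def)
  then have "factor x (k + m) n = factor z k n"
    by (simp add: factor_eq_iff algebra_simps)
  then show "\<exists>l. factor x l n = factor z k n" by blast
next
  assume z: "z \<in> topspace (full_shift A) \<and> (\<forall>k n. \<exists>l. factor x l n = factor z k n)"
  have "\<exists>y. y \<in> orbit x \<and> y \<in> T" if "z \<in> T" "openin (full_shift A) T" for T
  proof -
    have "\<exists>B. finite {i \<in> UNIV. B i \<noteq> topspace (discrete_topology A)} \<and>
        (\<forall>i\<in>UNIV. openin (discrete_topology A) (B i)) \<and> z \<in> Pi\<^sub>E UNIV B \<and> Pi\<^sub>E UNIV B \<subseteq> T"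
      using that unfolding full_shift_def openin_product_topology_alt by blast
    then obtain B where B: "finite {i. B i \<noteq> A}" "z \<in> Pi\<^sub>E UNIV B" "Pi\<^sub>E UNIV B \<subseteq> T"
      by (elim exE conjE) simp
    define K where "K = Max (insert 0 (abs ` {i. B i \<noteq> A}))"
    have K: "\<bar>i\<bar> \<le> K" if "B i \<noteq> A" for i
      unfolding K_def using B(1) that by (intro Max_ge) auto
    define n where "n = nat (2 * K + 1)"
    obtain l where "factor x l n = factor z (- K) n" using z by blast
    then have l: "x (l + t) = z (- K + t)" if "0 \<le> t" "t < 2 * K + 1" for t
      using that unfolding factor_eq_iff_int n_def by auto
    have "x (i + (l + K)) \<in> B i" for i
    proof (cases "B i = A")
      case True
      then show ?thesis using assms by (simp add: topspace_full_shift)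
    next
      case False
      then have "x (l + (i + K)) = z i"
        using K[OF False] l[of "i + K"] by auto
      then show ?thesis using B(2) by (auto simp: algebra_simps)
    qed
    then have "shift_pow (l + K) x \<in> T"
      using B(3) by (auto simp: shift_pow_def)
    then show ?thesis by (auto simp: orbit_def)
  qed
  with z show "z \<in> full_shift A closure_of orbit x"
    by (auto simp: in_closure_of)
qed

lemma shift_pow_add: "shift_pow m (shift_pow n x) = shift_pow (m + n) x"
  by (simp add: shift_pow_def add.assoc)

lemma orbit_subset_subshift:
  assumes "subshift A Y" "y \<in> Y"
  shows "orbit y \<subseteq> Y"
proof -
  have inv: "shift ` Y = Y" using assms(1) by (simp add: subshift_def)
  have shift: "shift_pow 1 u \<in> Y" if "u \<in> Y" for u
    using inv that by blast
  have unshift: "shift_pow (-1) u \<in> Y" if "u \<in> Y" for u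
  proof -
    have "u \<in> shift ` Y" using inv that by simp
    then obtain v where "v \<in> Y" "u = shift_pow 1 v" by (rule imageE)
    then show ?thesis by (simp add: shift_pow_add) (simp add: shift_pow_def)
  qed
  have "shift_pow m y \<in> Y" for m
  proof (induction m rule: int_induct[where k = 0])
    case base
    then show ?case using assms(2) by (simp add: shift_pow_def)
  next
    case (step1 i)
    then show ?case using shift[of "shift_pow i y"] by (simp add: shift_pow_add add.commute)
  next
    case (step2 i)
    then show ?case using unshift[of "shift_pow i y"] by (simp add: shift_pow_add)
  qed
  then show ?thesis by (auto simp: orbit_def)
qed

theorem mainTheorem5:
  fixes A :: "'a set" and X :: "(int \<Rightarrow> 'a) set"
  assumes "finite A"
    and "transitive_subshift A X"
    and "limsup (\<lambda>n. ereal (real (complexity X n) - real n)) = \<infinity>"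
    and "limsup (\<lambda>n. ereal (real (complexity X n) - 3 / 2 * real n)) < \<infinity>"
  shows "minimal_subshift A X"
proof (rule ccontr)
  assume not_min: "\<not> minimal_subshift A X"
  obtain x where x: "x \<in> topspace (full_shift A)" and X: "X = full_shift A closure_of orbit x"
    and sub: "subshift A X"
    using assms(2) unfolding transitive_subshift_def by blast
  have fin: "finite (range z)" if "z \<in> topspace (full_shift A)" for z
    using that by (intro finite_subset[OF _ assms(1)]) (auto simp: topspace_full_shift)
  have xX: "x \<in> X"
    using x unfolding X closure_of_orbit[OF x] by blast
  have X_factor: "\<exists>l. factor x l n = factor z k n" if "z \<in> X" for z k n
    using that unfolding X closure_of_orbit[OF x] by blast
  have "words X n = words {x} n" for n
    using xX X_factor by (auto simp: words_eq_factors) metis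
  then have complexity: "complexity X n = card (words {x} n)" for n
    by (simp add: complexity_def)
  obtain Y where Y: "subshift A Y" "Y \<noteq> {}" "Y \<subset> X"
    using not_min sub unfolding minimal_subshift_def by blast
  then obtain y where y: "y \<in> Y" "y \<in> X" by blast
  have yt: "y \<in> topspace (full_shift A)"
    using y(2) unfolding X by (simp add: in_closure_of)
  have closure_y: "full_shift A closure_of orbit y \<subseteq> Y"
    using Y(1) orbit_subset_subshift[OF Y(1) y(1)]
    by (intro closure_of_minimal) (auto simp: subshift_def)
  have "x \<notin> full_shift A closure_of orbit y"
  proof
    assume "x \<in> full_shift A closure_of orbit y"
    then have "orbit x \<subseteq> Y"
      using closure_y orbit_subset_subshift[OF Y(1)] by blast
    then have "X \<subseteq> Y"
      using Y(1) unfolding X by (intro closure_of_minimal) (auto simp: subshift_def)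
    with Y(3) show False by blast
  qed
  then obtain k0 m where w: "\<And>l. factor y l m \<noteq> factor x k0 m"
    using x unfolding closure_of_orbit[OF yt] by blast
  have aper: "\<not> (eventually_periodic x \<and> eventually_periodic (\<lambda>i. x (- i)))"
  proof
    assume "eventually_periodic x \<and> eventually_periodic (\<lambda>i. x (- i))"
    then obtain M where M: "\<And>n. card (words {x} n) \<le> n + M"
      using eventually_periodic_complexity by blast
    have "limsup (\<lambda>n. ereal (real (complexity X n) - real n)) \<le> ereal (real M)"
    proof (intro Limsup_bounded always_eventually allI)
      fix n
      show "ereal (real (complexity X n) - real n) \<le> ereal (real M)"
        using M[of n] by (simp add: complexity)
    qed
    with assms(3) show False by simp
  qed
  have "unbounded_excess x"
  proof (cases "\<exists>q>0. \<forall>i. y (i + q) = y i")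
    case True
    then obtain q where q: "q > 0" "\<And>i. y (i + q) = y i" by blast
    show ?thesis
    proof (rule periodic_factor_excess[OF fin[OF x] q(1) _ aper])
      fix n
      obtain l where "factor x l (n + nat q) = factor y 0 (n + nat q)"
        using X_factor[OF y(2)] by blast
      then have l: "x (l + t) = y t" if "0 \<le> t" "t < int n + q" for t
        using that q(1) unfolding factor_eq_iff_int by simp
      have "x (l + t + q) = x (l + t)" if "0 \<le> t" "t < int n" for t
        using l[of t] l[of "t + q"] that q by (simp add: add.assoc)
      then show "\<exists>k. \<forall>t. 0 \<le> t \<and> t < int n \<longrightarrow> x (k + t + q) = x (k + t)" by blast
    qed
  next
    case False
    have "n + 1 \<le> card {factor x k n | k. \<forall>j. k \<le> j \<and> j + int m \<le> k + int n \<longrightarrow>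
        factor x j m \<noteq> factor x k0 m}" (is "_ \<le> card ?G") for n
    proof -
      have "n + 1 \<le> card (words {y} n)"
        by (rule aperiodic_factors[OF fin[OF yt]]) (use False in blast)
      also have "\<dots> \<le> card ?G"
      proof (rule card_mono)
        show "finite ?G"
          by (rule finite_subset[OF _ finite_words_single[OF fin[OF x], of n]])
             (auto simp: words_single)
        show "words {y} n \<subseteq> ?G"
        proof
          fix u assume "u \<in> words {y} n"
          then obtain k' where k': "u = factor y k' n" by (auto simp: words_single)
          obtain k where k: "factor x k n = factor y k' n"
            using X_factor[OF y(2)] by blast
          have "factor x j m \<noteq> factor x k0 m" if "k \<le> j" "j + int m \<le> k + int n" for j
            using factor_sub[OF k, of "j - k" m] w[of "k' + (j - k)"] that by simp
          then show "u \<in> ?G" using k k' by (intro CollectI exI[of _ k]) simp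
        qed
      qed
      finally show ?thesis .
    qed
    from complexity_with_marker[OF fin[OF x] refl this] show ?thesis
      by (rule unbounded_excess_linear)
  qed
  moreover obtain M :: nat
    where "limsup (\<lambda>n. ereal (real (complexity X n) - 3 / 2 * real n)) < ereal (real M)"
    using assms(4) less_PInf_Ex_of_nat by auto
  then have "eventually (\<lambda>n. ereal (real (complexity X n) - 3 / 2 * real n) < ereal (real M)) sequentially"
    by (rule Limsup_lessD)
  then obtain N where N: "\<And>n. n \<ge> N \<Longrightarrow> real (complexity X n) - 3 / 2 * real n < real M"
    unfolding eventually_sequentially by auto
  ultimately obtain n where n: "n \<ge> N + 2 * M" "3 * n + (N + 2 * M) \<le> 2 * card (words {x} n)"
    unfolding unbounded_excess_def by blast
  then have "3 * real n + (real N + 2 * real M) \<le> 2 * real (complexity X n)"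
    unfolding complexity by linarith
  with N[of n] n(1) show False by simp
qed

end
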